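(* Let $$B=\begin{pmatrix}\alpha_1&r&s\\0&\alpha_2&t\\0&0&\alpha_3\end{pmatrix}\in\mathbb{C}^{3\times 3}$$ and assume that no two of the upper triangular entries $r,s,t$ vanish simultaneously (i.e. $\alpha_1\Bumpeq\alpha_2\Bumpeq\alpha_3$). If $rst=0$, then $\mathcal{F}_B=\varnothing$. If $rst\ne 0$, then $\mathcal{F}_B$ is either empty or consists of a single point. In the latter case, $$\mathcal{F}_B\subset\{\lambda\in\mathbb{C}:\arg(\alpha_2-\lambda)=\arg(r\overline{s}t)\}.$$
   Context: For a matrix $A\in\mathbb{C}^{n\times n}$, identify $\mathbb{C}$ with $\mathbb{R}^2$ via $\lambda=x+iy\equiv(x,y)$ and let $s_1(\lambda)\ge\dots\ge s_n(\lambda)\ge 0$ be the singular values of $\lambda I-A$. Let $\Sigma_j:=\{(x,y,s_j^2(x,y)) : (x,y)\in\mathbb{R}^2\}$, and let $p:\{1,\dots,n\}\to\{1,\dots,n\}$ be a map choosing one index for each of the different surfaces among the $\Sigma_j$: $\Sigma_j=\Sigma_{p(j)}$ for all $j$; $\bigcup_j\Sigma_j=\bigcup_j\Sigma_{p(j)}$; and $\Sigma_{p(j)}=\Sigma_{p(k)}$ if and only if $p(j)=p(k)$. The set of fault points of $A$ is $$\mathcal{F}_A:=\{(x,y): s_{p(n)}(x,y)=s_{p(k)}(x,y)\text{ for some }k\text{ such that }p(n)\ne p(k)\}.$$ Block equivalence: for an upper triangular matrix $T=(t_{ij})$ with diagonal entries $\alpha_i=t_{ii}$ (entries in different positions regarded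 as different), $\alpha_i\bumpeq\alpha_j$ means $i=j$, or $i<j$ and $t_{ij}\ne0$, or $i>j$ and $t_{ji}\ne 0$; $\alpha_i\Bumpeq\alpha_j$ means that $\alpha_i$ and $\alpha_j$ are connected by a finite chain of $\bumpeq$ relations.
   Formalization: In the case rst = 0 the formal statement also assumes that not both r = 0 and α₁ = α₂, and not both t = 0 and α₂ = α₃; in these excluded cases α₂ is a fault point, so the claim as printed fails. *)

theory Defs
  imports
    "Jordan_Normal_Form.Char_Poly"
    "Jordan_Normal_Form.Schur_Decomposition"
begin

text \<open>The eigenvalues of \<open>M\<^sup>* M\<close> are real and non-negative, so \<^const>\<open>Re\<close> only
  changes the type. They are counted with multiplicity and listed in decreasing order.\<close>

definition singular_values :: "complex mat \<Rightarrow> real list" where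
  "singular_values M =
     rev (sorted_list_of_multiset
       (image_mset (\<lambda>\<mu>. sqrt (Re \<mu>)) (proots (char_poly (mat_adjoint M * M)))))"

text \<open>The index \<open>j\<close> runs from 1, the list index from 0.\<close>

definition sv :: "complex mat \<Rightarrow> nat \<Rightarrow> complex \<Rightarrow> real" where
  "sv A j z = singular_values (z \<cdot>\<^sub>m 1\<^sub>m (dim_row A) - A) ! (j - 1)"

definition sv_surface :: "complex mat \<Rightarrow> nat \<Rightarrow> (real \<times> real \<times> real) set" where
  "sv_surface A j = {(x, y, (sv A j (Complex x y))\<^sup>2) | x y. True}"

definition surface_selector :: "complex mat \<Rightarrow> (nat \<Rightarrow> nat) \<Rightarrow> bool" where
  "surface_selector A p \<longleftrightarrow>
     p \<in> {1..dim_row A} \<rightarrow> {1..dim_row A} \<and>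
     (\<forall>j\<in>{1..dim_row A}. sv_surface A j = sv_surface A (p j)) \<and>
     (\<Union>j\<in>{1..dim_row A}. sv_surface A j) = (\<Union>j\<in>{1..dim_row A}. sv_surface A (p j)) \<and>
     (\<forall>j\<in>{1..dim_row A}. \<forall>k\<in>{1..dim_row A}.
        sv_surface A (p j) = sv_surface A (p k) \<longleftrightarrow> p j = p k)"

text \<open>The plane of points \<open>(x, y)\<close> is identified with the complex plane.\<close>

definition fault_points :: "complex mat \<Rightarrow> (nat \<Rightarrow> nat) \<Rightarrow> complex set" where
  "fault_points A p =
     {z. \<exists>k\<in>{1..dim_row A}. p (dim_row A) \<noteq> p k \<and> sv A (p (dim_row A)) z = sv A (p k) z}"

lemma surface_selector_exists: "\<exists>p. surface_selector A p"
proof -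
  define I where "I = {1..dim_row A}"
  define p where "p j = (LEAST k. k \<in> I \<and> sv_surface A k = sv_surface A j)" for j
  have p: "p j \<in> I \<and> sv_surface A (p j) = sv_surface A j" if "j \<in> I" for j
    unfolding p_def by (rule LeastI[of _ j]) (use that in blast)
  have surf: "sv_surface A j = sv_surface A (p j)" if "j \<in> I" for j
    using p[OF that] by metis
  have eq: "sv_surface A (p j) = sv_surface A (p k) \<longleftrightarrow> p j = p k" if "j \<in> I" "k \<in> I" for j k
  proof
    assume "sv_surface A (p j) = sv_surface A (p k)"
    then have "sv_surface A j = sv_surface A k"
      by (metis surf that)
    then show "p j = p k"
      by (metis p_def)
  qed metis
  have un: "(\<Union>j\<in>I. sv_surface A j) = (\<Union>j\<in>I. sv_surface A (p j))"
    by (rule SUP_cong[OF refl surf])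
  have "surface_selector A p"
    unfolding surface_selector_def I_def[symmetric]
    by (intro conjI ballI Pi_I surf un eq) (metis p)
  then show ?thesis by blast
qed

end

theory Submission
  imports Defs
begin

text \<open>At a fault point \<open>\<lambda>\<close> the two smallest singular values of \<open>M = \<lambda>I - B\<close> coincide, so the
  smallest eigenvalue \<open>\<mu>\<close> of the Gram matrix \<open>G = M\<^sup>* M\<close> is at least double and \<open>G - \<mu>I\<close> is a
  positive semidefinite matrix of rank at most one. All its \<open>2 \<times> 2\<close> minors vanish. Write
  \<open>a = \<lambda> - \<alpha>\<^sub>1\<close>, \<open>b = \<lambda> - \<alpha>\<^sub>2\<close>; two of the minors give
    \<open>r * cnj b * t = - ((cmod b)\<^sup>2 - \<mu>) * s\<close> (for \<open>a \<noteq> 0\<close>) and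
    \<open>((cmod a)\<^sup>2 - \<mu>) * cnj b * t = - \<mu> * cnj r * s\<close>.

  If \<open>a = 0\<close>, then \<open>\<mu> = 0\<close>, and what replaces the first relation is the dependence of the last
  two columns of \<open>M\<close> (\<open>gram_rank1_shift_a_zero\<close>).

  If one of \<open>r, s, t\<close> is zero, the minors contradict each other, unless the smallest
  singular value is zero and \<open>r = 0\<close>, \<open>\<alpha>\<^sub>1 = \<alpha>\<^sub>2\<close> or \<open>t = 0\<close>, \<open>\<alpha>\<^sub>2 = \<alpha>\<^sub>3\<close>
  (\<open>gram_rank1_shift_zero_entry\<close>).

  If \<open>r * s * t \<noteq> 0\<close>, the first relation makes \<open>\<alpha>\<^sub>2 - \<lambda> = - b\<close> a real multiple \<open>\<beta>\<close> of
  \<open>w = r * cnj s * t\<close>, and the second makes \<open>\<beta>\<close> positive, because \<open>(cmod a)\<^sup>2 \<ge> \<mu>\<close>; this is the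
  assertion on the argument. The relations also express \<open>(cmod a)\<^sup>2\<close> as a quadratic polynomial
  in \<open>\<beta>\<close> (\<open>gram_rank1_shift_ray\<close>). On the other hand \<open>a = (\<alpha>\<^sub>2 - \<alpha>\<^sub>1) - \<beta> * w\<close>, and equating the
  two expressions leaves a linear equation for \<open>\<beta>\<close> with non-zero constant term. So \<open>\<beta>\<close>,
  and with it \<open>\<lambda>\<close>, is unique (\<open>ray_parameter_unique\<close>).

  The rank-one property is obtained without diagonalising: the sum of the squared moduli of
  the minors of a Hermitian matrix is \<open>e\<^sub>2\<^sup>2 - 2 e\<^sub>1 e\<^sub>3\<close> in terms of the elementary symmetric
  functions of its eigenvalues (\<open>hermitian3_minors_vanish\<close>).\<close>

section \<open>Singular values and the Gram matrix\<close>

lemma cnj_mult_self: "cnj z * z = of_real ((cmod z)\<^sup>2)"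
  by (metis complex_norm_square mult.commute)

lemma gram_index:
  assumes "M \<in> carrier_mat n n" "i < n" "j < n"
  shows "(mat_adjoint M * M) $$ (i, j) = (\<Sum>k<n. cnj (M $$ (k, i)) * M $$ (k, j))"
  using assms
  by (auto simp: mat_adjoint_def scalar_prod_def atLeast0LessThan intro!: sum.cong)

lemma gram_carrier:
  assumes "M \<in> carrier_mat n n"
  shows "mat_adjoint M * M \<in> carrier_mat n n"
  using assms by (auto simp: mat_adjoint_def)

text \<open>For an eigenvector \<open>v\<close> of \<open>M\<^sup>* M\<close> with eigenvalue \<open>x\<close>, the squared length of
  \<open>M v\<close> is \<open>x\<close> times the squared length of \<open>v\<close>.\<close>

lemma eigenvalue_gram_nonneg:
  fixes M :: "complex mat"
  assumes M: "M \<in> carrier_mat n n" and ev: "eigenvalue (mat_adjoint M * M) x"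
  shows "x \<in> \<real>" and "0 \<le> Re x"
proof -
  let ?G = "mat_adjoint M * M"
  obtain v where v: "v \<in> carrier_vec n" "v \<noteq> 0\<^sub>v n" "?G *\<^sub>v v = x \<cdot>\<^sub>v v"
    using ev gram_carrier[OF M] by (auto simp: eigenvalue_def eigenvector_def)
  note cn = cnj_mult_self[symmetric]
  define N where "N = (\<Sum>i<n. (cmod (v $ i))\<^sup>2)"
  define w where "w k = (\<Sum>j<n. M $$ (k, j) * v $ j)" for k
  define W where "W = (\<Sum>k<n. (cmod (w k))\<^sup>2)"
  have row: "(\<Sum>j<n. ?G $$ (i, j) * v $ j) = x * v $ i" if "i < n" for i
  proof -
    have "(?G *\<^sub>v v) $ i = (\<Sum>j<n. ?G $$ (i, j) * v $ j)"
      using that v(1) gram_carrier[OF M]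
      by (auto simp: scalar_prod_def atLeast0LessThan carrier_matD simp del: index_mult_mat intro!: sum.cong)
    then show ?thesis using v that by simp
  qed
  have "x * of_real N = (\<Sum>i<n. cnj (v $ i) * (x * v $ i))"
    unfolding N_def of_real_sum sum_distrib_left by (rule sum.cong) (simp_all only: cn mult_ac)
  also have "\<dots> = (\<Sum>i<n. cnj (v $ i) * (\<Sum>j<n. ?G $$ (i, j) * v $ j))"
    by (rule sum.cong) (auto simp: row)
  also have "\<dots> = (\<Sum>i<n. \<Sum>j<n. \<Sum>k<n. cnj (v $ i) * cnj (M $$ (k, i)) * (M $$ (k, j) * v $ j))"
    by (intro sum.cong refl)
      (simp add: gram_index[OF M] sum_distrib_left sum_distrib_right mult.assoc del: index_mult_mat)
  also have "\<dots> = (\<Sum>i<n. \<Sum>k<n. \<Sum>j<n. cnj (v $ i) * cnj (M $$ (k, i)) * (M $$ (k, j) * v $ j))"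
    by (intro sum.cong refl sum.swap)
  also have "\<dots> = (\<Sum>k<n. \<Sum>i<n. \<Sum>j<n. cnj (v $ i) * cnj (M $$ (k, i)) * (M $$ (k, j) * v $ j))"
    by (rule sum.swap)
  also have "\<dots> = (\<Sum>k<n. cnj (w k) * w k)"
    unfolding w_def cnj_sum sum_product by (simp only: complex_cnj_mult mult_ac)
  also have "\<dots> = of_real W"
    unfolding W_def of_real_sum cn ..
  finally have eq: "x * of_real N = of_real W" .
  obtain i where "i < n" "v $ i \<noteq> 0"
    using v by (auto simp: vec_eq_iff)
  then have "N > 0"
    unfolding N_def by (intro sum_pos2[of _ i]) auto
  then have x: "x = of_real (W / N)"
    using eq by (simp add: field_simps)
  show "x \<in> \<real>" unfolding x by simp
  have "W \<ge> 0" unfolding W_def by (intro sum_nonneg) auto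
  then show "0 \<le> Re x" using \<open>N > 0\<close> unfolding x by simp
qed

text \<open>Since the roots of the characteristic polynomial of \<open>M\<^sup>* M\<close> are real and
  non-negative, taking \<^const>\<open>Re\<close> and the square root loses nothing: the squares of the
  singular values recover the polynomial.\<close>

lemma singular_values_spec:
  assumes M: "M \<in> carrier_mat n n"
  shows "length (singular_values M) = n"
    and "sorted (rev (singular_values M))"
    and "\<forall>l\<in>set (singular_values M). 0 \<le> l"
    and "char_poly (mat_adjoint M * M) = (\<Prod>l\<leftarrow>singular_values M. [:- of_real (l\<^sup>2), 1:])"
proof -
  let ?c = "char_poly (mat_adjoint M * M)"
  let ?f = "\<lambda>\<mu>. sqrt (Re \<mu>)"
  note G = gram_carrier[OF M]
  have deg: "degree ?c = n" and lc: "lead_coeff ?c = 1"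
    using degree_monic_char_poly[OF G] by auto
  then have c0: "?c \<noteq> 0" by auto
  have m: "mset (singular_values M) = image_mset ?f (proots ?c)"
    by (simp add: singular_values_def)
  have real: "of_real ((?f x)\<^sup>2) = x \<and> 0 \<le> Re x" if "x \<in># proots ?c" for x
  proof -
    have "eigenvalue (mat_adjoint M * M) x"
      using that c0 by (simp add: eigenvalue_root_char_poly[OF G])
    from eigenvalue_gram_nonneg[OF M this] show ?thesis by simp
  qed
  show "length (singular_values M) = n"
    using arg_cong[OF m, of size] deg by (simp add: size_proots_complex)
  show "sorted (rev (singular_values M))"
    by (simp add: singular_values_def)
  show "\<forall>l\<in>set (singular_values M). 0 \<le> l"
    using arg_cong[OF m, of set_mset] real by auto
  have "?c = (\<Prod>x\<in>#proots ?c. [:- x, 1:])"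
    using complex_poly_decompose_multiset[of ?c] lc by simp
  also have "image_mset (\<lambda>x. [:- x, 1:]) (proots ?c)
      = image_mset (\<lambda>x. [:- of_real ((?f x)\<^sup>2), 1:]) (proots ?c)"
    by (rule image_mset_cong) (metis real)
  also have "\<dots> = image_mset (\<lambda>l. [:- of_real (l\<^sup>2), 1:]) (mset (singular_values M))"
    by (simp add: m multiset.map_comp o_def)
  also have "prod_mset \<dots> = (\<Prod>l\<leftarrow>singular_values M. [:- of_real (l\<^sup>2), 1:])"
    unfolding mset_map[symmetric] by (rule prod_mset_prod_list)
  finally show "?c = (\<Prod>l\<leftarrow>singular_values M. [:- of_real (l\<^sup>2), 1:])" .
qed

section \<open>Hermitian matrices of order three with a double smallest eigenvalue\<close>

lemma det_3x3:
  fixes A :: "'a :: comm_ring_1 mat"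
  assumes A: "A \<in> carrier_mat 3 3"
  shows "det A =
      A $$ (0,0) * (A $$ (1,1) * A $$ (2,2) - A $$ (1,2) * A $$ (2,1))
    - A $$ (0,1) * (A $$ (1,0) * A $$ (2,2) - A $$ (1,2) * A $$ (2,0))
    + A $$ (0,2) * (A $$ (1,0) * A $$ (2,1) - A $$ (1,1) * A $$ (2,0))"
proof -
  have 1: "det X = X $$ (0,0)" if X: "X \<in> carrier_mat 1 1" for X :: "'a mat"
  proof -
    have "mat_delete X 0 0 \<in> carrier_mat 0 0"
      using mat_delete_carrier[OF X] by simp
    then show ?thesis
      using laplace_expansion_row[OF X, of 0] by (simp add: cofactor_def)
  qed
  have 2: "det X = X $$ (0,0) * X $$ (1,1) - X $$ (0,1) * X $$ (1,0)"
    if X: "X \<in> carrier_mat 2 2" for X :: "'a mat"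
  proof -
    have "det (mat_delete X 0 j) = mat_delete X 0 j $$ (0,0)" for j
      by (rule 1) (use mat_delete_carrier[OF X] in simp)
    then show ?thesis
      using laplace_expansion_row[OF X, of 0] X
      by (simp add: cofactor_def mat_delete_def numeral_2_eq_2 lessThan_Suc)
  qed
  have "det (mat_delete A 0 j) = mat_delete A 0 j $$ (0,0) * mat_delete A 0 j $$ (1,1)
      - mat_delete A 0 j $$ (0,1) * mat_delete A 0 j $$ (1,0)" for j
    by (rule 2) (use mat_delete_carrier[OF A] in simp)
  then show ?thesis
    using laplace_expansion_row[OF A, of 0] A
    by (simp add: cofactor_def mat_delete_def numeral_3_eq_3 numeral_2_eq_2 lessThan_Suc)
      (simp add: algebra_simps)
qed

text \<open>The first assumption says that the second elementary symmetric function \<open>e\<^sub>2\<close> of the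
  eigenvalues of the Hermitian matrix with diagonal \<open>p, q, u\<close> and upper entries \<open>x, y, z\<close> is
  zero; the second says that its determinant \<open>e\<^sub>3\<close> is zero. The adjugate is Hermitian with
  eigenvalues the products of two of the original ones, hence its squared Frobenius norm is
  \<open>e\<^sub>2\<^sup>2 - 2 e\<^sub>1 e\<^sub>3 = 0\<close>. So all \<open>2 \<times> 2\<close> minors vanish, which is the rank-one conclusion of
  the spectral theorem without diagonalising.\<close>

lemma hermitian3_minors_vanish:
  fixes p q u :: real and x y z :: complex
  assumes e2: "p * q + p * u + q * u - (cmod x)\<^sup>2 - (cmod y)\<^sup>2 - (cmod z)\<^sup>2 = 0"
    and e3: "p * q * u + 2 * Re (x * z * cnj y)
               - p * (cmod z)\<^sup>2 - q * (cmod y)\<^sup>2 - u * (cmod x)\<^sup>2 = 0"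
  shows "p * q = (cmod x)\<^sup>2" "p * u = (cmod y)\<^sup>2" "q * u = (cmod z)\<^sup>2"
    and "p * z = cnj x * y" "q * y = x * z" "u * x = y * cnj z"
proof -
  define m where "m = p * q - (cmod x)\<^sup>2"
  define m' where "m' = p * u - (cmod y)\<^sup>2"
  define m'' where "m'' = q * u - (cmod z)\<^sup>2"
  define n where "n = p * z - cnj x * y"
  define n' where "n' = q * y - x * z"
  define n'' where "n'' = u * x - y * cnj z"
  \<comment> \<open>Both sides are the squared Frobenius norm of the adjugate.\<close>
  have "m\<^sup>2 + m'\<^sup>2 + m''\<^sup>2 + 2 * (cmod n)\<^sup>2 + 2 * (cmod n')\<^sup>2 + 2 * (cmod n'')\<^sup>2
     = (p * q + p * u + q * u - (cmod x)\<^sup>2 - (cmod y)\<^sup>2 - (cmod z)\<^sup>2)\<^sup>2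
       - 2 * (p + q + u) * (p * q * u + 2 * Re (x * z * cnj y)
               - p * (cmod z)\<^sup>2 - q * (cmod y)\<^sup>2 - u * (cmod x)\<^sup>2)"
    unfolding m_def m'_def m''_def n_def n'_def n''_def cmod_power2
    by (simp add: power2_eq_square algebra_simps)
  then have sum0: "m\<^sup>2 + m'\<^sup>2 + m''\<^sup>2 + 2 * (cmod n)\<^sup>2 + 2 * (cmod n')\<^sup>2 + 2 * (cmod n'')\<^sup>2 = 0"
    using e2 e3 by simp
  have nonneg: "0 \<le> m\<^sup>2" "0 \<le> m'\<^sup>2" "0 \<le> m''\<^sup>2" "0 \<le> (cmod n)\<^sup>2" "0 \<le> (cmod n')\<^sup>2" "0 \<le> (cmod n'')\<^sup>2"
    by simp_all
  have "m\<^sup>2 = 0" "m'\<^sup>2 = 0" "m''\<^sup>2 = 0" "(cmod n)\<^sup>2 = 0" "(cmod n')\<^sup>2 = 0" "(cmod n'')\<^sup>2 = 0"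
    using sum0 nonneg by linarith+
  then show "p * q = (cmod x)\<^sup>2" "p * u = (cmod y)\<^sup>2" "q * u = (cmod z)\<^sup>2"
    and "p * z = cnj x * y" "q * y = x * z" "u * x = y * cnj z"
    by (simp_all add: m_def m'_def m''_def n_def n'_def n''_def)
qed

text \<open>Needed for the diagonal \<open>p, q, u\<close> of a Hermitian matrix of rank at most one with
  non-negative trace: there the products are squared moduli, so the entries cannot have
  opposite signs.\<close>

lemma nonneg_of_products:
  fixes p q u :: real
  assumes "0 \<le> p * q" "0 \<le> p * u" "0 \<le> p + q + u"
  shows "0 \<le> p"
proof (rule ccontr)
  assume "\<not> 0 \<le> p"
  then have "p < 0" by simp
  then have "q \<le> 0" "u \<le> 0"
    using assms(1,2) by (auto simp: zero_le_mult_iff)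
  then show False using assms(3) \<open>p < 0\<close> by linarith
qed

lemma poly_char_poly_hermitian3:
  fixes H :: "complex mat" and p q u k :: real and x y z :: complex
  assumes H: "H \<in> carrier_mat 3 3"
    and "H $$ (0,0) = of_real p" "H $$ (1,1) = of_real q" "H $$ (2,2) = of_real u"
    and "H $$ (0,1) = x" "H $$ (0,2) = y" "H $$ (1,2) = z"
    and "H $$ (1,0) = cnj x" "H $$ (2,0) = cnj y" "H $$ (2,1) = cnj z"
  shows "poly (char_poly H) (of_real k) =
    of_real ((k - p) * (k - q) * (k - u) - (k - p) * (cmod z)\<^sup>2 - (k - q) * (cmod y)\<^sup>2
             - (k - u) * (cmod x)\<^sup>2 - 2 * Re (x * z * cnj y))"
proof -
  have C: "- char_matrix H (of_real k) \<in> carrier_mat 3 3"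
    using H by simp
  show ?thesis
    unfolding char_poly_matrix[OF H] det_3x3[OF C] cmod_power2
    using assms[unfolded One_nat_def]
    by (simp add: char_matrix_def complex_eq_iff power2_eq_square algebra_simps)
qed

text \<open>Shifting by the double eigenvalue \<open>\<mu>\<close> makes \<open>e\<^sub>2\<close> and \<open>e\<^sub>3\<close> vanish, so the shifted
  matrix has rank at most one. That \<open>\<mu>\<close> is the smallest eigenvalue enters through the
  trace \<open>\<nu> - \<mu> \<ge> 0\<close> and yields the bound on the diagonal entry.\<close>

lemma hermitian3_double_bottom_eigenvalue:
  fixes H :: "complex mat" and p q u \<mu> \<nu> :: real and x y z :: complex
  assumes H: "H \<in> carrier_mat 3 3"
    "H $$ (0,0) = of_real p" "H $$ (1,1) = of_real q" "H $$ (2,2) = of_real u"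
    "H $$ (0,1) = x" "H $$ (0,2) = y" "H $$ (1,2) = z"
    "H $$ (1,0) = cnj x" "H $$ (2,0) = cnj y" "H $$ (2,1) = cnj z"
    and roots: "char_poly H = [:- of_real \<nu>, 1:] * [:- of_real \<mu>, 1:]\<^sup>2"
    and le: "\<mu> \<le> \<nu>"
  shows "\<mu> \<le> p"
    and "(p - \<mu>) * (q - \<mu>) = (cmod x)\<^sup>2" "(p - \<mu>) * (u - \<mu>) = (cmod y)\<^sup>2"
    and "(q - \<mu>) * (u - \<mu>) = (cmod z)\<^sup>2"
    and "of_real (p - \<mu>) * z = cnj x * y" "of_real (q - \<mu>) * y = x * z"
proof -
  define P where "P = p - \<mu>"
  define Q where "Q = q - \<mu>"
  define U where "U = u - \<mu>"
  define e2 where "e2 = P * Q + P * U + Q * U - (cmod x)\<^sup>2 - (cmod y)\<^sup>2 - (cmod z)\<^sup>2"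
  define e3 where "e3 = P * Q * U + 2 * Re (x * z * cnj y)
    - P * (cmod z)\<^sup>2 - Q * (cmod y)\<^sup>2 - U * (cmod x)\<^sup>2"
  \<comment> \<open>The characteristic polynomial at \<open>\<mu> + \<kappa>\<close>, computed from the entries and from the roots.\<close>
  have eq: "\<kappa> ^ 3 - (P + Q + U) * \<kappa>\<^sup>2 + e2 * \<kappa> - e3 = (\<kappa> - (\<nu> - \<mu>)) * \<kappa>\<^sup>2" for \<kappa>
  proof -
    have "poly (char_poly H) (of_real (\<mu> + \<kappa>)) = of_real ((\<kappa> - (\<nu> - \<mu>)) * \<kappa>\<^sup>2)"
      unfolding roots by (simp add: algebra_simps)
    moreover have "poly (char_poly H) (of_real (\<mu> + \<kappa>))
        = of_real (\<kappa> ^ 3 - (P + Q + U) * \<kappa>\<^sup>2 + e2 * \<kappa> - e3)"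
      unfolding poly_char_poly_hermitian3[OF H] of_real_eq_iff P_def Q_def U_def e2_def e3_def
      by (simp add: power2_eq_square power3_eq_cube algebra_simps)
    ultimately show ?thesis by (metis of_real_eq_iff)
  qed
  have e: "e3 = 0" "e2 = 0" "P + Q + U = \<nu> - \<mu>"
    using eq[of 0] eq[of 1] eq[of "-1"] by simp_all
  note m = hermitian3_minors_vanish[OF e(2,1)[unfolded e2_def e3_def]]
  show "(p - \<mu>) * (q - \<mu>) = (cmod x)\<^sup>2" "(p - \<mu>) * (u - \<mu>) = (cmod y)\<^sup>2"
    "(q - \<mu>) * (u - \<mu>) = (cmod z)\<^sup>2"
    "of_real (p - \<mu>) * z = cnj x * y" "of_real (q - \<mu>) * y = x * z"
    using m unfolding P_def Q_def U_def by simp_all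
  have "0 \<le> P"
    by (rule nonneg_of_products[of P Q U]) (use m e(3) le in simp_all)
  then show "\<mu> \<le> p" by (simp add: P_def)
qed

section \<open>Triangular matrices whose two smallest singular values coincide\<close>

text \<open>For the upper triangular matrix with diagonal \<open>a, b, c\<close> and upper entries \<open>-r, -s, -t\<close>
  (the form of \<open>\<lambda>I - B\<close>), with Gram matrix \<open>G\<close>, the equations are \<open>2 \<times> 2\<close> minors of \<open>G - \<mu>I\<close>:
  the three principal ones, and those in rows \<open>{1, 2}\<close> with columns \<open>{1, 3}\<close> and \<open>{2, 3}\<close>.
  The bound \<open>\<mu> \<le> (cmod a)\<^sup>2\<close> records that no eigenvalue of \<open>G\<close> is below \<open>\<mu>\<close>.\<close>

definition gram_rank1_shift ::
    "complex \<Rightarrow> complex \<Rightarrow> complex \<Rightarrow> complex \<Rightarrow> complex \<Rightarrow> complex \<Rightarrow> real \<Rightarrow> bool" where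
  "gram_rank1_shift a b c r s t \<mu> \<longleftrightarrow>
     0 \<le> \<mu> \<and> \<mu> \<le> (cmod a)\<^sup>2 \<and>
     ((cmod a)\<^sup>2 - \<mu>) * ((cmod s)\<^sup>2 + (cmod t)\<^sup>2 + (cmod c)\<^sup>2 - \<mu>) = (cmod a)\<^sup>2 * (cmod s)\<^sup>2 \<and>
     ((cmod a)\<^sup>2 - \<mu>) * ((cmod r)\<^sup>2 + (cmod b)\<^sup>2 - \<mu>) = (cmod a)\<^sup>2 * (cmod r)\<^sup>2 \<and>
     ((cmod r)\<^sup>2 + (cmod b)\<^sup>2 - \<mu>) * ((cmod s)\<^sup>2 + (cmod t)\<^sup>2 + (cmod c)\<^sup>2 - \<mu>)
       = (cmod (cnj r * s - cnj b * t))\<^sup>2 \<and>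
     of_real ((cmod a)\<^sup>2 - \<mu>) * (cnj r * s - cnj b * t) = of_real ((cmod a)\<^sup>2) * (cnj r * s) \<and>
     of_real ((cmod r)\<^sup>2 + (cmod b)\<^sup>2 - \<mu>) * (cnj a * s) = cnj a * r * (cnj r * s - cnj b * t)"

lemma gram_rank1_shift_of_singular_values:
  fixes a b c r s t :: complex
  assumes M: "M \<in> carrier_mat 3 3"
    "M $$ (0,0) = a" "M $$ (0,1) = - r" "M $$ (0,2) = - s"
    "M $$ (1,0) = 0" "M $$ (1,1) = b" "M $$ (1,2) = - t"
    "M $$ (2,0) = 0" "M $$ (2,1) = 0" "M $$ (2,2) = c"
    and eq: "singular_values M ! 1 = singular_values M ! 2"
  shows "\<exists>\<mu>. gram_rank1_shift a b c r s t \<mu>"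
proof -
  let ?G = "mat_adjoint M * M"
  note sv = singular_values_spec[OF M(1)]
  obtain l1 l2 l3 where l: "singular_values M = [l1, l2, l3]"
    using sv(1) by (auto simp: numeral_3_eq_3 length_Suc_conv)
  then have "l2 = l3" "0 \<le> l2" "l2 \<le> l1"
    using eq sv(2,3) by simp_all
  have G: "?G \<in> carrier_mat 3 3" by (rule gram_carrier[OF M(1)])
  have Gij: "?G $$ (i, j) = cnj (M $$ (0, i)) * M $$ (0, j) + cnj (M $$ (1, i)) * M $$ (1, j)
      + cnj (M $$ (2, i)) * M $$ (2, j)" if "i < 3" "j < 3" for i j
    using gram_index[OF M(1) that] by (simp add: numeral_3_eq_3 numeral_2_eq_2 lessThan_Suc add_ac)
  have roots: "char_poly ?G = [:- of_real (l1\<^sup>2), 1:] * [:- of_real (l2\<^sup>2), 1:]\<^sup>2"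
    using sv(4) unfolding l \<open>l2 = l3\<close>[symmetric] by (simp add: power2_eq_square)
  have le: "l2\<^sup>2 \<le> l1\<^sup>2" using \<open>0 \<le> l2\<close> \<open>l2 \<le> l1\<close> by simp
  have "?G $$ (0,0) = of_real ((cmod a)\<^sup>2)"
    "?G $$ (1,1) = of_real ((cmod r)\<^sup>2 + (cmod b)\<^sup>2)"
    "?G $$ (2,2) = of_real ((cmod s)\<^sup>2 + (cmod t)\<^sup>2 + (cmod c)\<^sup>2)"
    "?G $$ (0,1) = - (cnj a * r)" "?G $$ (0,2) = - (cnj a * s)"
    "?G $$ (1,2) = cnj r * s - cnj b * t"
    "?G $$ (1,0) = cnj (- (cnj a * r))" "?G $$ (2,0) = cnj (- (cnj a * s))"
    "?G $$ (2,1) = cnj (cnj r * s - cnj b * t)"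
    unfolding of_real_add cnj_mult_self[symmetric]
    by (simp_all add: Gij M(2-)[unfolded One_nat_def] del: index_mult_mat)
  note D = hermitian3_double_bottom_eigenvalue[OF G this roots le]
  have "of_real ((cmod a)\<^sup>2 - l2\<^sup>2) * (cnj r * s - cnj b * t) = of_real ((cmod a)\<^sup>2) * (cnj r * s)"
    using D(5) unfolding cnj_mult_self[symmetric] by (simp add: mult_ac)
  moreover have "of_real ((cmod r)\<^sup>2 + (cmod b)\<^sup>2 - l2\<^sup>2) * (cnj a * s)
      = cnj a * r * (cnj r * s - cnj b * t)"
    using D(6) by simp
  ultimately have "gram_rank1_shift a b c r s t (l2\<^sup>2)"
    using D(1-4) unfolding gram_rank1_shift_def by (simp add: norm_mult power_mult_distrib)
  then show ?thesis ..
qed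

text \<open>The minor in rows \<open>{1, 2}\<close> and columns \<open>{1, 3}\<close> gives the next relation; the one in
  columns \<open>{2, 3}\<close> gives the relation after it, once a factor \<open>cnj a\<close> is cancelled. In both,
  \<open>cnj b\<close> is the only non-real factor besides \<open>r, s, t\<close> and their conjugates, so \<open>b\<close> is
  known up to a real factor, and together they determine the sign of this factor.\<close>

lemma gram_rank1_shift_rel_mu:
  assumes "gram_rank1_shift a b c r s t \<mu>"
  shows "of_real ((cmod a)\<^sup>2 - \<mu>) * cnj b * t = - of_real \<mu> * cnj r * s"
  using assms by (simp add: gram_rank1_shift_def algebra_simps)

lemma gram_rank1_shift_rel_b:
  assumes R: "gram_rank1_shift a b c r s t \<mu>" and "a \<noteq> 0"
  shows "r * cnj b * t = - of_real ((cmod b)\<^sup>2 - \<mu>) * s"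
proof -
  have "cnj a * (of_real ((cmod r)\<^sup>2 + (cmod b)\<^sup>2 - \<mu>) * s) = cnj a * (r * (cnj r * s - cnj b * t))"
    using R unfolding gram_rank1_shift_def by (simp only: mult_ac)
  then have "of_real ((cmod r)\<^sup>2 + (cmod b)\<^sup>2 - \<mu>) * s = r * (cnj r * s - cnj b * t)"
    using \<open>a \<noteq> 0\<close> by (metis complex_cnj_zero_iff mult_left_cancel)
  also have "\<dots> = (cnj r * r) * s - r * cnj b * t"
    by (simp add: algebra_simps)
  finally show ?thesis
    unfolding cnj_mult_self by (simp add: algebra_simps)
qed

text \<open>If \<open>a = 0\<close>, then \<open>\<mu> = 0\<close> and the last two columns of the triangular matrix are
  dependent; by Lagrange's identity the vanishing Gram determinant of these columns is the
  sum of the squared moduli of their \<open>2 \<times> 2\<close> minors.\<close>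

lemma gram_rank1_shift_a_zero:
  assumes R: "gram_rank1_shift a b c r s t \<mu>" and "a = 0"
  shows "r * t + s * b = 0" "r * c = 0" "b * c = 0"
proof -
  have \<mu>: "\<mu> = 0" using R \<open>a = 0\<close> by (simp add: gram_rank1_shift_def)
  have "(cmod (r * t + s * b))\<^sup>2 + (cmod (r * c))\<^sup>2 + (cmod (b * c))\<^sup>2
      = ((cmod r)\<^sup>2 + (cmod b)\<^sup>2) * ((cmod s)\<^sup>2 + (cmod t)\<^sup>2 + (cmod c)\<^sup>2)
        - (cmod (cnj r * s - cnj b * t))\<^sup>2"
    unfolding cmod_power2 by (simp add: power2_eq_square algebra_simps)
  also have "\<dots> = 0"
    using R \<mu> by (simp add: gram_rank1_shift_def)
  finally have "(cmod (r * t + s * b))\<^sup>2 = 0" "(cmod (r * c))\<^sup>2 = 0" "(cmod (b * c))\<^sup>2 = 0"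
    using zero_le_power2[of "cmod (r * t + s * b)"] zero_le_power2[of "cmod (r * c)"]
      zero_le_power2[of "cmod (b * c)"] by linarith+
  then show "r * t + s * b = 0" "r * c = 0" "b * c = 0" by simp_all
qed

text \<open>These inequalities keep the two relations from degenerating to \<open>0 = 0\<close> when \<open>a \<noteq> 0\<close>;
  if one failed, a principal minor would force \<open>t = 0\<close> or \<open>r = s = 0\<close>.\<close>

lemma gram_rank1_shift_nondegenerate:
  assumes R: "gram_rank1_shift a b c r s t \<mu>"
    and "a \<noteq> 0" "t \<noteq> 0" "\<not> (r = 0 \<and> s = 0)"
  shows "0 < \<mu>" "b \<noteq> 0"
proof -
  have \<mu>: "0 \<le> \<mu>" "\<mu> \<le> (cmod a)\<^sup>2"
   and d13: "((cmod a)\<^sup>2 - \<mu>) * ((cmod s)\<^sup>2 + (cmod t)\<^sup>2 + (cmod c)\<^sup>2 - \<mu>) = (cmod a)\<^sup>2 * (cmod s)\<^sup>2"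
   and d12: "((cmod a)\<^sup>2 - \<mu>) * ((cmod r)\<^sup>2 + (cmod b)\<^sup>2 - \<mu>) = (cmod a)\<^sup>2 * (cmod r)\<^sup>2"
    using R unfolding gram_rank1_shift_def by blast+
  show "0 < \<mu>"
  proof (rule ccontr)
    assume "\<not> 0 < \<mu>"
    then have "\<mu> = 0" using \<mu> by simp
    then have "(cmod a)\<^sup>2 * ((cmod t)\<^sup>2 + (cmod c)\<^sup>2) = 0"
      using d13 by (simp add: algebra_simps)
    then have "(cmod t)\<^sup>2 + (cmod c)\<^sup>2 = 0" using \<open>a \<noteq> 0\<close> by simp
    then show False using \<open>t \<noteq> 0\<close> by (simp add: sum_power2_eq_zero_iff)
  qed
  show "b \<noteq> 0"
  proof
    assume b: "b = 0"
    then have s: "s = 0" using gram_rank1_shift_rel_b[OF R \<open>a \<noteq> 0\<close>] \<open>0 < \<mu>\<close> by simp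
    have "\<mu> * (((cmod a)\<^sup>2 - \<mu>) + (cmod r)\<^sup>2) = 0"
      using d12 b by (simp add: algebra_simps)
    then have "((cmod a)\<^sup>2 - \<mu>) + (cmod r)\<^sup>2 = 0" using \<open>0 < \<mu>\<close> by simp
    then have "(cmod r)\<^sup>2 = 0" using \<mu>(2) zero_le_power2[of "cmod r"] by linarith
    then show False using \<open>\<not> (r = 0 \<and> s = 0)\<close> s by simp
  qed
qed

text \<open>Some minor would equate zero with a product of non-zero numbers, except in the two
  configurations of the conclusion; in both of them \<open>\<mu>\<close> and the two equal diagonal entries
  are in fact zero.\<close>

lemma gram_rank1_shift_zero_entry:
  assumes R: "gram_rank1_shift a b c r s t \<mu>"
    and nz: "\<not> (r = 0 \<and> s = 0)" "\<not> (r = 0 \<and> t = 0)" "\<not> (s = 0 \<and> t = 0)"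
    and "r * s * t = 0"
  shows "r = 0 \<and> a = b \<or> t = 0 \<and> b = c"
proof (cases "a = 0")
  case True
  show ?thesis using gram_rank1_shift_a_zero[OF R True] True nz \<open>r * s * t = 0\<close> by auto
next
  case False
  note E1 = gram_rank1_shift_rel_b[OF R False]
  note E2 = gram_rank1_shift_rel_mu[OF R]
  have d: "((cmod a)\<^sup>2 - \<mu>) * ((cmod s)\<^sup>2 + (cmod t)\<^sup>2 + (cmod c)\<^sup>2 - \<mu>) = (cmod a)\<^sup>2 * (cmod s)\<^sup>2"
   "((cmod a)\<^sup>2 - \<mu>) * ((cmod r)\<^sup>2 + (cmod b)\<^sup>2 - \<mu>) = (cmod a)\<^sup>2 * (cmod r)\<^sup>2"
    using R unfolding gram_rank1_shift_def by blast+
  show ?thesis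
  proof (cases "t = 0")
    case True
    then have rs: "r \<noteq> 0" "s \<noteq> 0" using nz by auto
    with E2 True have "\<mu> = 0" by simp
    moreover from this E1 True rs have "b = 0" by simp
    ultimately have "c = 0" using d True False by (simp add: algebra_simps)
    then show ?thesis using \<open>b = 0\<close> True by simp
  next
    case t: False
    note pos = gram_rank1_shift_nondegenerate[OF R False t nz(1)]
    have "r = 0" "s \<noteq> 0" using E1 \<open>r * s * t = 0\<close> t pos nz by auto
    have "(cmod a)\<^sup>2 = \<mu>" using E2 t pos \<open>r = 0\<close> by (simp flip: of_real_power)
    then show ?thesis using d(1) False \<open>s \<noteq> 0\<close> by simp
  qed
qed

text \<open>Multiplying the relation for \<open>b\<close> by \<open>b * cnj s\<close> shows that \<open>- b\<close> is a real multiple of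
  \<open>r * cnj s * t\<close>, with factor \<open>\<beta> = (cmod b)\<^sup>2 / ((cmod s)\<^sup>2 * D)\<close> for
  \<open>D = (cmod b)\<^sup>2 - \<mu>\<close>. Eliminating \<open>b\<close> between the two relations gives
  \<open>\<mu> * (cmod r)\<^sup>2 = ((cmod a)\<^sup>2 - \<mu>) * D\<close>, so \<open>D > 0\<close> because \<open>\<mu>\<close> is the smallest eigenvalue.
  Expressing \<open>\<mu>\<close> and \<open>D\<close> through \<open>\<beta>\<close>, by means of the modulus of the relation for \<open>b\<close>, turns
  the same identity into the formula for \<open>(cmod a)\<^sup>2\<close>.

  For \<open>a = 0\<close> the relation for \<open>b\<close> is replaced by the dependence of the last two columns.\<close>

lemma gram_rank1_shift_ray:
  assumes R: "gram_rank1_shift a b c r s t \<mu>"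
    and nz: "r \<noteq> 0" "s \<noteq> 0" "t \<noteq> 0"
  shows "\<exists>\<beta>>0. - b = of_real \<beta> * (r * cnj s * t) \<and>
     (cmod a)\<^sup>2 = (cmod r)\<^sup>2 * (\<beta> * (cmod s)\<^sup>2 - 1) * (\<beta> * (cmod t)\<^sup>2 + 1)"
proof (cases "a = 0")
  \<comment> \<open>Here the smallest singular value is zero, and the factor \<open>\<beta> * (cmod s)\<^sup>2 - 1\<close> vanishes.\<close>
  case True
  have "r * t + s * b = 0"
    using gram_rank1_shift_a_zero(1)[OF R True] .
  then have b: "s * b = - (r * t)" by (simp add: eq_neg_iff_add_eq_0 add.commute)
  have "of_real ((cmod s)\<^sup>2) * b = cnj s * (s * b)"
    by (simp only: cnj_mult_self[symmetric] mult.assoc)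
  also have "\<dots> = - (r * cnj s * t)" unfolding b by simp
  finally have "- b = of_real (1 / (cmod s)\<^sup>2) * (r * cnj s * t)"
    using nz by (simp add: field_simps)
  then show ?thesis using True nz by (intro exI[of _ "1 / (cmod s)\<^sup>2"]) auto
next
  case False
  define D where "D = (cmod b)\<^sup>2 - \<mu>"
  define A where "A = (cmod a)\<^sup>2 - \<mu>"
  have E1: "r * cnj b * t = - of_real D * s"
    using gram_rank1_shift_rel_b[OF R False] unfolding D_def .
  have E2: "of_real A * cnj b * t = - of_real \<mu> * cnj r * s"
    using gram_rank1_shift_rel_mu[OF R] unfolding A_def .
  have \<mu>: "\<mu> > 0" "b \<noteq> 0"
    using gram_rank1_shift_nondegenerate[OF R False nz(3)] nz by auto
  have "A \<ge> 0" using R unfolding gram_rank1_shift_def A_def by auto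
  have "D \<noteq> 0" using E1 nz \<mu> by auto
  have "s * of_real (\<mu> * (cmod r)\<^sup>2) = r * (of_real \<mu> * cnj r * s)"
    unfolding of_real_mult cnj_mult_self[symmetric] by (simp only: mult_ac)
  also have "\<dots> = - of_real A * (r * cnj b * t)"
    using E2 by (simp add: algebra_simps)
  also have "\<dots> = s * of_real (A * D)"
    unfolding E1 by simp
  finally have AD: "\<mu> * (cmod r)\<^sup>2 = A * D"
    using nz by (metis mult_left_cancel of_real_eq_iff)
  have "A * D > 0"
    unfolding AD[symmetric] using \<mu> nz by simp
  then have "D > 0" using \<open>A \<ge> 0\<close> by (simp add: zero_less_mult_iff)
  define \<beta> where "\<beta> = (cmod b)\<^sup>2 / ((cmod s)\<^sup>2 * D)"
  have "\<beta> > 0" unfolding \<beta>_def using \<open>D > 0\<close> \<mu> nz by simp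
  have "of_real ((cmod b)\<^sup>2) * (r * cnj s * t) = b * cnj s * (r * cnj b * t)"
    unfolding cnj_mult_self[symmetric] by (simp only: mult_ac)
  also have "\<dots> = - (of_real ((cmod s)\<^sup>2 * D) * b)"
    unfolding E1 of_real_mult cnj_mult_self[symmetric] by simp
  finally have "of_real ((cmod s)\<^sup>2 * D) * - b = of_real ((cmod b)\<^sup>2) * (r * cnj s * t)"
    by simp
  then have "- b = of_real \<beta> * (r * cnj s * t)"
    unfolding \<beta>_def of_real_divide using nz \<open>D \<noteq> 0\<close>
    by (simp add: field_simps)
  have "(cmod r * cmod b * cmod t)\<^sup>2 = (D * cmod s)\<^sup>2"
    using arg_cong[OF E1, of "\<lambda>x. (cmod x)\<^sup>2"] by (simp add: norm_mult power_mult_distrib)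
  then have T: "\<beta> * (cmod t)\<^sup>2 = D / (cmod r)\<^sup>2"
    unfolding \<beta>_def using nz \<open>D > 0\<close> by (simp add: field_simps power_mult_distrib power2_eq_square)
  have S: "\<beta> * (cmod s)\<^sup>2 - 1 = \<mu> / D"
    unfolding \<beta>_def using nz \<open>D > 0\<close> by (simp add: field_simps) (simp add: D_def)
  have "(cmod r)\<^sup>2 * (\<mu> / D) * (D / (cmod r)\<^sup>2 + 1) = \<mu> + \<mu> * (cmod r)\<^sup>2 / D"
    using nz \<open>D > 0\<close> by (simp add: field_simps)
  also have "\<dots> = (cmod a)\<^sup>2"
    unfolding AD using \<open>D > 0\<close> by (simp add: A_def)
  finally have "(cmod a)\<^sup>2 = (cmod r)\<^sup>2 * (\<beta> * (cmod s)\<^sup>2 - 1) * (\<beta> * (cmod t)\<^sup>2 + 1)"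
    unfolding S T ..
  then show ?thesis
    using \<open>\<beta> > 0\<close> \<open>- b = _\<close> by blast
qed

text \<open>Along the ray, \<open>a = d - \<beta> * w\<close> with \<open>w = r * cnj s * t\<close>, and both expressions for
  \<open>(cmod a)\<^sup>2\<close> are quadratic in \<open>\<beta>\<close> with the same leading coefficient \<open>(cmod w)\<^sup>2\<close>. The difference
  is a linear equation \<open>\<beta> * K = (cmod d)\<^sup>2 + (cmod r)\<^sup>2\<close> with positive right-hand side.\<close>

lemma ray_parameter_unique:
  fixes d r s t :: complex and \<beta> \<gamma> :: real
  assumes "(cmod (d - of_real \<beta> * (r * cnj s * t)))\<^sup>2
       = (cmod r)\<^sup>2 * (\<beta> * (cmod s)\<^sup>2 - 1) * (\<beta> * (cmod t)\<^sup>2 + 1)"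
   and "(cmod (d - of_real \<gamma> * (r * cnj s * t)))\<^sup>2
       = (cmod r)\<^sup>2 * (\<gamma> * (cmod s)\<^sup>2 - 1) * (\<gamma> * (cmod t)\<^sup>2 + 1)"
   and "r \<noteq> 0"
  shows "\<beta> = \<gamma>"
proof -
  define w where "w = r * cnj s * t"
  define K where "K = (cmod r)\<^sup>2 * ((cmod s)\<^sup>2 - (cmod t)\<^sup>2) + 2 * Re (d * cnj w)"
  have *: "x * K = (cmod d)\<^sup>2 + (cmod r)\<^sup>2"
    if "(cmod (d - of_real x * w))\<^sup>2 = (cmod r)\<^sup>2 * (x * (cmod s)\<^sup>2 - 1) * (x * (cmod t)\<^sup>2 + 1)" for x
  proof -
    have w2: "(cmod w)\<^sup>2 = (cmod r)\<^sup>2 * (cmod s)\<^sup>2 * (cmod t)\<^sup>2"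
      by (simp add: w_def norm_mult power_mult_distrib)
    have "(cmod (d - of_real x * w))\<^sup>2 = (cmod d)\<^sup>2 - 2 * x * Re (d * cnj w) + x\<^sup>2 * (cmod w)\<^sup>2"
      unfolding cmod_power2 by (simp add: power2_eq_square algebra_simps)
    with that show ?thesis
      unfolding w2 K_def by (simp add: power2_eq_square algebra_simps)
  qed
  have "\<beta> * K = (cmod d)\<^sup>2 + (cmod r)\<^sup>2" "\<gamma> * K = (cmod d)\<^sup>2 + (cmod r)\<^sup>2"
    using * assms(1,2) unfolding w_def by blast+
  moreover have "(cmod d)\<^sup>2 + (cmod r)\<^sup>2 > 0"
    using \<open>r \<noteq> 0\<close> by (intro add_nonneg_pos) auto
  ultimately show ?thesis
    by (metis less_irrefl mult_right_cancel mult_zero_right)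
qed

section \<open>Fault points\<close>

lemma sv_eq_of_surface_eq:
  assumes A: "A \<in> carrier_mat n n" and jk: "j \<in> {1..n}" "k \<in> {1..n}"
    and eq: "sv_surface A j = sv_surface A k"
  shows "sv A j z = sv A k z"
proof -
  have nonneg: "0 \<le> sv A i z" if "i \<in> {1..n}" for i
  proof -
    have "z \<cdot>\<^sub>m 1\<^sub>m (dim_row A) - A \<in> carrier_mat n n" using A by auto
    from singular_values_spec(1,3)[OF this] show ?thesis
      using that unfolding sv_def by auto
  qed
  have "(Re z, Im z, (sv A j (Complex (Re z) (Im z)))\<^sup>2) \<in> sv_surface A k"
    unfolding eq[symmetric] by (auto simp: sv_surface_def)
  then have "(sv A j z)\<^sup>2 = (sv A k z)\<^sup>2"
    by (auto simp: sv_surface_def)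
  then show ?thesis
    using nonneg jk by (simp add: power2_eq_iff_nonneg)
qed

text \<open>Passing to representatives of the surfaces does not change the singular values as
  functions of the point. If some earlier singular value meets the last one, then the
  next-to-last, lying between the two, does as well.\<close>

lemma fault_points_subset_coalescence:
  assumes A: "A \<in> carrier_mat n n" and p: "surface_selector A p" and z: "z \<in> fault_points A p"
  shows "sv A (n - 1) z = sv A n z"
proof -
  have n: "dim_row A = n" using A by simp
  obtain k where k: "k \<in> {1..n}" "p n \<noteq> p k" "sv A (p n) z = sv A (p k) z"
    using z unfolding fault_points_def n by blast
  have "n \<in> {1..n}" using k by simp
  have S: "sv A (p j) z = sv A j z" if "j \<in> {1..n}" for j
    using p that unfolding surface_selector_def n
    by (intro sv_eq_of_surface_eq[OF A]) auto
  have "sv A k z = sv A n z"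
    using k(3) S[OF k(1)] S[OF \<open>n \<in> {1..n}\<close>] by simp
  let ?L = "singular_values (z \<cdot>\<^sub>m 1\<^sub>m n - A)"
  have C: "z \<cdot>\<^sub>m 1\<^sub>m n - A \<in> carrier_mat n n" using A by auto
  have "k \<noteq> n" using k(2) by auto
  then have "k - 1 \<le> n - 2" "n - 2 \<le> n - 1" "n - 1 < length ?L"
    using k(1) singular_values_spec(1)[OF C] by auto
  moreover have "?L ! j \<le> ?L ! i" if "i \<le> j" "j < length ?L" for i j
    using singular_values_spec(2)[OF C] that by (rule sorted_rev_nth_mono)
  ultimately have "?L ! (n - 2) \<le> ?L ! (k - 1)" "?L ! (n - 1) \<le> ?L ! (n - 2)"
    by auto
  then show ?thesis
    using \<open>sv A k z = sv A n z\<close> unfolding sv_def n by (simp add: numeral_2_eq_2)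
qed

lemma Arg_of_real_mult:
  assumes "0 < x"
  shows "Arg (of_real x * w) = Arg w"
  using assms by (simp add: Arg_def sgn_mult sgn_of_real)

theorem theorem11:
  fixes \<alpha>\<^sub>1 \<alpha>\<^sub>2 \<alpha>\<^sub>3 r s t :: complex and B :: "complex mat" and p :: "nat \<Rightarrow> nat"
  assumes "B = mat_of_rows_list 3 [[\<alpha>\<^sub>1, r, s], [0, \<alpha>\<^sub>2, t], [0, 0, \<alpha>\<^sub>3]]"
    and "\<not> (r = 0 \<and> s = 0)" and "\<not> (r = 0 \<and> t = 0)" and "\<not> (s = 0 \<and> t = 0)"
    and "surface_selector B p"
  shows
    "(r * s * t = 0 \<longrightarrow> \<not> (r = 0 \<and> \<alpha>\<^sub>1 = \<alpha>\<^sub>2) \<longrightarrow> \<not> (t = 0 \<and> \<alpha>\<^sub>2 = \<alpha>\<^sub>3) \<longrightarrow>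
        fault_points B p = {}) \<and>
     (r * s * t \<noteq> 0 \<longrightarrow>
        (fault_points B p = {} \<or> (\<exists>w. fault_points B p = {w})) \<and>
        ((\<exists>w. fault_points B p = {w}) \<longrightarrow>
           fault_points B p \<subseteq> {z. z \<noteq> \<alpha>\<^sub>2 \<and> Arg (\<alpha>\<^sub>2 - z) = Arg (r * cnj s * t)}))"
proof -
  have B: "B \<in> carrier_mat 3 3"
    unfolding assms(1) mat_of_rows_list_def by (simp add: numeral_3_eq_3)
  have coalesce: "\<exists>\<mu>. gram_rank1_shift (z - \<alpha>\<^sub>1) (z - \<alpha>\<^sub>2) (z - \<alpha>\<^sub>3) r s t \<mu>"
    if z: "z \<in> fault_points B p" for z
  proof (rule gram_rank1_shift_of_singular_values)
    let ?M = "z \<cdot>\<^sub>m 1\<^sub>m 3 - B"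
    show "?M \<in> carrier_mat 3 3" using B by auto
    show "singular_values ?M ! 1 = singular_values ?M ! 2"
      using fault_points_subset_coalescence[OF B assms(5) z] B by (simp add: sv_def)
  qed (simp_all add: assms(1) mat_of_rows_list_def numeral_3_eq_3 numeral_2_eq_2)
  have "fault_points B p = {}"
    if "r * s * t = 0" "\<not> (r = 0 \<and> \<alpha>\<^sub>1 = \<alpha>\<^sub>2)" "\<not> (t = 0 \<and> \<alpha>\<^sub>2 = \<alpha>\<^sub>3)"
  proof -
    have False if "z \<in> fault_points B p" for z
      using coalesce[OF that] gram_rank1_shift_zero_entry[OF _ assms(2-4) \<open>r * s * t = 0\<close>]
        \<open>\<not> (r = 0 \<and> \<alpha>\<^sub>1 = \<alpha>\<^sub>2)\<close> \<open>\<not> (t = 0 \<and> \<alpha>\<^sub>2 = \<alpha>\<^sub>3)\<close> by fastforce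
    then show ?thesis by blast
  qed
  moreover have "(fault_points B p = {} \<or> (\<exists>w. fault_points B p = {w})) \<and>
      fault_points B p \<subseteq> {z. z \<noteq> \<alpha>\<^sub>2 \<and> Arg (\<alpha>\<^sub>2 - z) = Arg (r * cnj s * t)}"
    if "r * s * t \<noteq> 0"
  proof -
    have nz: "r \<noteq> 0" "s \<noteq> 0" "t \<noteq> 0" using that by auto
    let ?w = "r * cnj s * t"
    have ray: "\<exists>\<beta>>0. \<alpha>\<^sub>2 - z = of_real \<beta> * ?w \<and>
       (cmod (\<alpha>\<^sub>2 - \<alpha>\<^sub>1 - of_real \<beta> * ?w))\<^sup>2
         = (cmod r)\<^sup>2 * (\<beta> * (cmod s)\<^sup>2 - 1) * (\<beta> * (cmod t)\<^sup>2 + 1)"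
      if z: "z \<in> fault_points B p" for z
    proof -
      obtain \<mu> where "gram_rank1_shift (z - \<alpha>\<^sub>1) (z - \<alpha>\<^sub>2) (z - \<alpha>\<^sub>3) r s t \<mu>"
        using coalesce[OF z] by blast
      from gram_rank1_shift_ray[OF this nz] obtain \<beta> where \<beta>: "\<beta> > 0"
        "\<alpha>\<^sub>2 - z = of_real \<beta> * ?w"
        "(cmod (z - \<alpha>\<^sub>1))\<^sup>2 = (cmod r)\<^sup>2 * (\<beta> * (cmod s)\<^sup>2 - 1) * (\<beta> * (cmod t)\<^sup>2 + 1)"
        by auto
      have "z - \<alpha>\<^sub>1 = \<alpha>\<^sub>2 - \<alpha>\<^sub>1 - of_real \<beta> * ?w"
        unfolding \<beta>(2)[symmetric] by simp
      then show ?thesis using \<beta> by metis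
    qed
    have unique: "z = z'" if z: "z \<in> fault_points B p" and z': "z' \<in> fault_points B p" for z z'
    proof -
      obtain \<beta> where \<beta>: "\<alpha>\<^sub>2 - z = of_real \<beta> * ?w" "(cmod (\<alpha>\<^sub>2 - \<alpha>\<^sub>1 - of_real \<beta> * ?w))\<^sup>2
         = (cmod r)\<^sup>2 * (\<beta> * (cmod s)\<^sup>2 - 1) * (\<beta> * (cmod t)\<^sup>2 + 1)"
        using ray[OF z] by blast
      obtain \<gamma> where \<gamma>: "\<alpha>\<^sub>2 - z' = of_real \<gamma> * ?w" "(cmod (\<alpha>\<^sub>2 - \<alpha>\<^sub>1 - of_real \<gamma> * ?w))\<^sup>2
         = (cmod r)\<^sup>2 * (\<gamma> * (cmod s)\<^sup>2 - 1) * (\<gamma> * (cmod t)\<^sup>2 + 1)"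
        using ray[OF z'] by blast
      have "\<beta> = \<gamma>" by (rule ray_parameter_unique[OF \<beta>(2) \<gamma>(2) nz(1)])
      then have "\<alpha>\<^sub>2 - z = \<alpha>\<^sub>2 - z'" using \<beta>(1) \<gamma>(1) by simp
      then show ?thesis by simp
    qed
    have "fault_points B p \<subseteq> {z. z \<noteq> \<alpha>\<^sub>2 \<and> Arg (\<alpha>\<^sub>2 - z) = Arg ?w}"
    proof
      fix z assume "z \<in> fault_points B p"
      from ray[OF this] obtain \<beta> where "\<beta> > 0" "\<alpha>\<^sub>2 - z = of_real \<beta> * ?w" by blast
      moreover from this have "\<alpha>\<^sub>2 - z \<noteq> 0" using nz by simp
      ultimately show "z \<in> {z. z \<noteq> \<alpha>\<^sub>2 \<and> Arg (\<alpha>\<^sub>2 - z) = Arg ?w}"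
        by (auto simp: Arg_of_real_mult)
    qed
    moreover have "fault_points B p = {} \<or> (\<exists>w. fault_points B p = {w})"
      using unique by blast
    ultimately show ?thesis by blast
  qed
  ultimately show ?thesis by blast
qed

end
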